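(* Let $E$ and $F$ be Banach spaces and let $T : \mathfrak{D}(T) \subset E \to F$ be an unbounded linear operator. Assume that $T$ is closed. Then the following two assertions are equivalent. (i) $\operatorname{Im} T$ is closed in $F$. (ii) There exists $c > 0$ such that for every $y \in \operatorname{Im} T$ there exists $x \in \mathfrak{D}(T)$ with $T(x) = y$ and $\Vert x \Vert_E \leq c\, \Vert y \Vert_F$.
   Context: As usual, an "unbounded linear operator" $T : \mathfrak{D}(T) \subset E \to F$ means a (not necessarily bounded) linear map defined on a vector subspace $\mathfrak{D}(T)$ of $E$ with values in $F$. $T$ is closed if its graph $\{(x, T(x)) : x \in \mathfrak{D}(T)\}$ is closed in $E \times F$. $\operatorname{Im} T = \{T(x) : x \in \mathfrak{D}(T)\}$ is the range of $T$. *)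

theory Defs
  imports "HOL-Analysis.Analysis"
begin

(* A linear map on a subspace D is represented by D together with a total function T;
   the values of T outside D are irrelevant to all notions below. *)

definition unbounded_operator ::
    "'a::real_normed_vector set \<Rightarrow> ('a \<Rightarrow> 'b::real_normed_vector) \<Rightarrow> bool" where
  "unbounded_operator D T \<longleftrightarrow> subspace D \<and>
     (\<forall>x\<in>D. \<forall>y\<in>D. T (x + y) = T x + T y) \<and>
     (\<forall>r. \<forall>x\<in>D. T (r *\<^sub>R x) = r *\<^sub>R T x)"

definition op_graph :: "'a set \<Rightarrow> ('a \<Rightarrow> 'b) \<Rightarrow> ('a \<times> 'b) set" where
  "op_graph D T = {(x, T x) | x. x \<in> D}"

definition closed_operator ::
    "'a::real_normed_vector set \<Rightarrow> ('a \<Rightarrow> 'b::real_normed_vector) \<Rightarrow> bool" where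
  "closed_operator D T \<longleftrightarrow> closed (op_graph D T)"

end

theory Submission
  imports Defs
begin

text \<open>Both directions rest on successive approximation: if every \<open>y\<close> in a set \<open>S\<close> is approximated
  up to \<open>\<parallel>y\<parallel> / 2\<close> by some \<open>T x\<close> with \<open>\<parallel>x\<parallel> \<le> K \<parallel>y\<parallel>\<close>, with the error again in \<open>S\<close>, then summing
  the corrections and using that the graph is closed solves \<open>T x = y\<close> exactly with \<open>\<parallel>x\<parallel> \<le> 2 K \<parallel>y\<parallel>\<close>.
  A uniform solution bound gives such approximations for \<open>S\<close> the closure of the range, which is
  therefore contained in the range. If the range is closed, the approximations for \<open>S\<close> the range
  itself come from Baire's theorem, applied to the closures of the images of balls.\<close>

section \<open>Algebra of linear maps defined on a subspace\<close>

lemma unbounded_operator_subspace: "unbounded_operator D T \<Longrightarrow> subspace D"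
  by (simp add: unbounded_operator_def)

lemma unbounded_operator_add:
  "unbounded_operator D T \<Longrightarrow> x \<in> D \<Longrightarrow> y \<in> D \<Longrightarrow> T (x + y) = T x + T y"
  by (simp add: unbounded_operator_def)

lemma unbounded_operator_scaleR:
  "unbounded_operator D T \<Longrightarrow> x \<in> D \<Longrightarrow> T (r *\<^sub>R x) = r *\<^sub>R T x"
  by (simp add: unbounded_operator_def)

lemma unbounded_operator_zero: "unbounded_operator D T \<Longrightarrow> T 0 = 0"
  using unbounded_operator_scaleR[of D T 0 0]
  by (simp add: unbounded_operator_subspace subspace_0)

lemma unbounded_operator_diff:
  assumes "unbounded_operator D T" "x \<in> D" "y \<in> D"
  shows "T (x - y) = T x - T y"
proof -
  have "x - y \<in> D"
    using subspace_diff unbounded_operator_subspace assms by blast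
  from unbounded_operator_add[OF assms(1) this assms(3)] show ?thesis
    by (simp add: eq_diff_eq)
qed

lemma unbounded_operator_sum:
  fixes f :: "nat \<Rightarrow> 'a::real_normed_vector"
  assumes "unbounded_operator D T" "\<And>i. f i \<in> D"
  shows "T (\<Sum>i<n. f i) = (\<Sum>i<n. T (f i))"
proof (induction n)
  case 0
  then show ?case using assms(1) by (simp add: unbounded_operator_zero)
next
  case (Suc n)
  have "(\<Sum>i<n. f i) \<in> D"
    by (intro subspace_sum unbounded_operator_subspace[OF assms(1)] assms(2))
  then show ?case
    using Suc assms by (simp add: unbounded_operator_add)
qed

lemma subspace_range:
  assumes "unbounded_operator D T"
  shows "subspace (T ` D)"
proof -
  note D = unbounded_operator_subspace[OF assms]
  show ?thesis
    unfolding subspace_def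
  proof (intro conjI ballI allI)
    show "0 \<in> T ` D"
      using unbounded_operator_zero[OF assms] subspace_0[OF D] by (metis image_eqI)
    show "x + y \<in> T ` D" if xy: "x \<in> T ` D" "y \<in> T ` D" for x y
    proof -
      obtain u v where uv: "u \<in> D" "v \<in> D" "x = T u" "y = T v"
        using xy by blast
      then have "x + y = T (u + v)"
        by (simp add: unbounded_operator_add[OF assms])
      then show ?thesis
        using subspace_add[OF D uv(1,2)] by blast
    qed
    show "c *\<^sub>R x \<in> T ` D" if x: "x \<in> T ` D" for c x
    proof -
      obtain u where u: "u \<in> D" "x = T u"
        using x by blast
      then have "c *\<^sub>R x = T (c *\<^sub>R u)"
        by (simp add: unbounded_operator_scaleR[OF assms])
      then show ?thesis
        using subspace_scale[OF D u(1)] by blast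
    qed
  qed
qed

text \<open>Translation by an element of \<open>S\<close> is an isometry that maps \<open>S\<close>
  into itself. This keeps the error \<open>y - T x\<close> in the closure of the range during the
  approximation.\<close>

lemma closure_subspace_diff:
  fixes S :: "'a::real_normed_vector set"
  assumes "subspace S" "x \<in> closure S" "y \<in> S"
  shows "x - y \<in> closure S"
  unfolding closure_approachable
proof (intro allI impI)
  fix e :: real assume "0 < e"
  then obtain z where "z \<in> S" "dist z x < e"
    using assms(2) by (auto simp: closure_approachable)
  then show "\<exists>w\<in>S. dist w (x - y) < e"
    using subspace_diff[OF assms(1) _ assms(3), of z]
    by (intro bexI[of _ "z - y"]) (simp_all add: dist_norm)
qed

section \<open>Closed graphs and successive approximation\<close>

lemma closed_operator_limit:
  assumes "closed_operator D T" "\<And>n. s n \<in> D" "s \<longlonglongrightarrow> x" "(\<lambda>n. T (s n)) \<longlonglongrightarrow> y"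
  shows "x \<in> D \<and> T x = y"
proof -
  have "(x, y) \<in> op_graph D T"
  proof (rule closed_sequentially)
    show "closed (op_graph D T)"
      using assms(1) by (simp add: closed_operator_def)
    show "(s n, T (s n)) \<in> op_graph D T" for n
      using assms(2) by (auto simp: op_graph_def)
    show "(\<lambda>n. (s n, T (s n))) \<longlonglongrightarrow> (x, y)"
      by (intro tendsto_Pair assms)
  qed
  then show ?thesis
    by (auto simp: op_graph_def)
qed

text \<open>Each correction at least halves the error, so the corrections are dominated by a
  geometric series of ratio 1/2; its sum produces the factor 2. Completeness of the domain space
  gives a limit, and the closed graph identifies its image. \<open>S\<close> is left general to
  cover both the range and its closure.\<close>

lemma closed_operator_successive_approximation:
  fixes T :: "'e::banach \<Rightarrow> 'f::real_normed_vector"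
  assumes T: "unbounded_operator D T" "closed_operator D T" and "0 \<le> K"
    and step: "\<And>y. y \<in> S \<Longrightarrow>
      \<exists>x\<in>D. norm x \<le> K * norm y \<and> norm (y - T x) \<le> norm y / 2 \<and> y - T x \<in> S"
    and "y \<in> S"
  shows "\<exists>x\<in>D. T x = y \<and> norm x \<le> 2 * K * norm y"
proof -
  obtain g where g: "\<And>z. z \<in> S \<Longrightarrow> g z \<in> D \<and> norm (g z) \<le> K * norm z \<and>
      norm (z - T (g z)) \<le> norm z / 2 \<and> z - T (g z) \<in> S"
    using step by metis
  \<comment> \<open>\<open>r n\<close> is the error left after \<open>n\<close> corrections, and
    \<open>f n\<close> is the correction applied to it.\<close>
  define r where "r n = ((\<lambda>z. z - T (g z)) ^^ n) y" for n
  define f where "f n = g (r n)" for n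
  have r0: "r 0 = y" and rSuc: "r (Suc n) = r n - T (f n)" for n
    by (simp_all add: r_def f_def)
  have rS: "r n \<in> S" for n
    by (induction n) (use \<open>y \<in> S\<close> g in \<open>auto simp: r0 rSuc f_def\<close>)
  have fD: "f n \<in> D" for n
    using g rS by (simp add: f_def)
  have r_le: "norm (r n) \<le> norm y * (1/2) ^ n" for n
  proof (induction n)
    case (Suc n)
    have "norm (r (Suc n)) \<le> norm (r n) / 2"
      using g[OF rS[of n]] by (simp add: rSuc f_def)
    with Suc show ?case by simp
  qed (simp add: r0)
  have f_le: "norm (f n) \<le> (K * norm y) * (1/2) ^ n" for n
    using g[OF rS[of n]] mult_left_mono[OF r_le[of n] \<open>0 \<le> K\<close>] by (simp add: f_def mult.assoc)
  have geo: "(\<lambda>n. (K * norm y) * (1/2::real) ^ n) sums (2 * K * norm y)"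
    using sums_mult[OF geometric_sums[of "1/2::real"], of "K * norm y"]
    by (simp add: mult_ac)
  have f_sums: "summable f"
    by (rule summable_comparison_test'[OF sums_summable[OF geo], of 0]) (use f_le in auto)
  have norm_le: "norm (suminf f) \<le> 2 * K * norm y"
    using norm_suminf_le[OF f_le sums_summable[OF geo]] sums_unique[OF geo] by simp
  \<comment> \<open>The images of the corrections telescope, since
    \<open>T (f n) = r n - r (Suc n)\<close>.\<close>
  have T_part: "T (\<Sum>i<n. f i) = y - r n" for n
    unfolding unbounded_operator_sum[OF T(1) fD]
    by (induction n) (simp_all add: r0 rSuc algebra_simps)
  have "(\<lambda>n. norm y * (1/2::real) ^ n) \<longlonglongrightarrow> 0"
    by (intro tendsto_mult_right_zero LIMSEQ_power_zero) simp
  then have "r \<longlonglongrightarrow> 0"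
    by (rule Lim_null_comparison[rotated]) (simp add: r_le)
  then have "(\<lambda>n. T (\<Sum>i<n. f i)) \<longlonglongrightarrow> y"
    unfolding T_part using tendsto_diff[OF tendsto_const, of r 0] by fastforce
  moreover have "(\<Sum>i<n. f i) \<in> D" for n
    by (intro subspace_sum unbounded_operator_subspace[OF T(1)] fD)
  ultimately have "suminf f \<in> D \<and> T (suminf f) = y"
    using closed_operator_limit[OF T(2) _ summable_LIMSEQ[OF f_sums]] by blast
  with norm_le show ?thesis by blast
qed

section \<open>Baire category and approximate solutions\<close>

lemma closed_union_some_interior:
  fixes R :: "'f::complete_space set" and A :: "nat \<Rightarrow> 'f set"
  assumes "closed R" "R \<noteq> {}" "R \<subseteq> (\<Union>n. A n)" "\<And>n. A n \<subseteq> R"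
  obtains n a e where "a \<in> R" "0 < e" "R \<inter> ball a e \<subseteq> closure (A n)"
proof -
  let ?X = "top_of_set R"
  have clo: "closure (A n) \<subseteq> R" for n
    using assms(1,4) by (simp add: closure_minimal)
  have "\<exists>n. ?X interior_of closure (A n) \<noteq> {}"
  proof (rule ccontr)
    assume none: "\<not> ?thesis"
    have "completely_metrizable_space ?X"
      using assms(1) closed_closedin completely_metrizable_space_closedin
        completely_metrizable_space_euclidean by blast
    moreover have "closedin ?X (closure (A n))" for n
      using clo by (simp add: closed_subset)
    ultimately have "?X interior_of \<Union>(range (\<lambda>n. closure (A n))) = {}"
      by (intro Baire_category_alt) (use none in auto)
    moreover have "\<Union>(range (\<lambda>n. closure (A n))) = R"
    proof
      show "\<Union>(range (\<lambda>n. closure (A n))) \<subseteq> R"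
        using clo by blast
      have "(\<Union>n. A n) \<subseteq> (\<Union>n. closure (A n))"
        by (intro UN_mono closure_subset order_refl)
      with assms(3) show "R \<subseteq> \<Union>(range (\<lambda>n. closure (A n)))"
        by (rule order_trans)
    qed
    ultimately show False
      using assms(2) interior_of_topspace[of ?X] by simp
  qed
  then obtain n a U where U: "openin ?X U" "a \<in> U" "U \<subseteq> closure (A n)"
    by (auto simp: interior_of_def)
  then obtain e where "a \<in> R" "0 < e" "ball a e \<inter> R \<subseteq> U"
    unfolding openin_contains_ball by blast
  with U show thesis
    by (intro that[of a e n]) auto
qed

text \<open>Baire's theorem yields a relative ball of the range in which images of a fixed ball are
  dense. Taking differences moves its centre to 0, and homogeneity extends the bound to the whole
  range, with \<open>K\<close> independent of the tolerance \<open>d\<close>.\<close>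

lemma approximate_solution_bound:
  fixes T :: "'e::real_normed_vector \<Rightarrow> 'f::banach"
  assumes T: "unbounded_operator D T" and clo: "closed (T ` D)"
  obtains K where "0 < K"
    "\<And>y d. y \<in> T ` D \<Longrightarrow> 0 < d \<Longrightarrow> \<exists>x\<in>D. norm x \<le> K * norm y \<and> norm (y - T x) < d"
proof -
  note D = unbounded_operator_subspace[OF T] and R = subspace_range[OF T]
  define A where "A n = T ` (D \<inter> cball 0 (real n))" for n
  have cover: "T ` D \<subseteq> (\<Union>n. A n)"
  proof (intro image_subsetI)
    fix x assume "x \<in> D"
    obtain n where "norm x \<le> real n"
      using real_arch_simple by blast
    with \<open>x \<in> D\<close> have "T x \<in> A n"
      by (simp add: A_def)
    then show "T x \<in> (\<Union>n. A n)"
      by blast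
  qed
  have sub: "A n \<subseteq> T ` D" for n
    by (auto simp: A_def)
  have ne: "T ` D \<noteq> {}"
    using subspace_0[OF R] by blast
  obtain n a e where ae: "a \<in> T ` D" "0 < e" "T ` D \<inter> ball a e \<subseteq> closure (A n)"
    by (rule closed_union_some_interior[OF clo ne cover sub])
  have near: "\<exists>x\<in>D. norm x \<le> real n \<and> norm (z - T x) < d"
    if "z \<in> T ` D \<inter> ball a e" "0 < d" for z d
  proof -
    have "z \<in> closure (A n)" using ae that by blast
    then show ?thesis
      using \<open>0 < d\<close> unfolding closure_approachable A_def
      by (fastforce simp: dist_norm norm_minus_commute)
  qed
  \<comment> \<open>Write \<open>y\<close> as \<open>(a + y) - a\<close>, with both terms in the
    ball around \<open>a\<close>. Approximating each within \<open>d / 2\<close> costs a doubling of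
    the radius.\<close>
  have small: "\<exists>x\<in>D. norm x \<le> 2 * real n \<and> norm (y - T x) < d"
    if y: "y \<in> T ` D" "norm y < e" "0 < d" for y d
  proof -
    obtain x1 where x1: "x1 \<in> D" "norm x1 \<le> real n" "norm (a + y - T x1) < d / 2"
      using near[of "a + y" "d / 2"] y ae subspace_add[OF R] by (auto simp: dist_norm)
    obtain x2 where x2: "x2 \<in> D" "norm x2 \<le> real n" "norm (a - T x2) < d / 2"
      using near[of a "d / 2"] y ae by auto
    have "norm (x1 - x2) \<le> 2 * real n"
      using x1 x2 norm_triangle_ineq4[of x1 x2] by simp
    moreover have "y - T (x1 - x2) = (a + y - T x1) - (a - T x2)"
      using x1 x2 by (simp add: unbounded_operator_diff[OF T])
    then have "norm (y - T (x1 - x2)) \<le> norm (a + y - T x1) + norm (a - T x2)"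
      by (simp only: norm_triangle_ineq4)
    then have "norm (y - T (x1 - x2)) < d"
      using x1 x2 by simp
    ultimately show ?thesis
      using subspace_diff[OF D x1(1) x2(1)] by blast
  qed
  \<comment> \<open>Rescaling by \<open>t = e / (2 * norm y)\<close> turns the radius
    \<open>2 * real n\<close> into \<open>4 * real n / e * norm y\<close>; the added 1 keeps
    \<open>K\<close> positive when \<open>n = 0\<close>.\<close>
  define K where "K = 4 * (real n + 1) / e"
  have "0 < K" using ae by (simp add: K_def)
  moreover have "\<exists>x\<in>D. norm x \<le> K * norm y \<and> norm (y - T x) < d"
    if y: "y \<in> T ` D" and "0 < d" for y d
  proof (cases "y = 0")
    case True
    then show ?thesis
      using \<open>0 < d\<close> by (intro bexI[of _ 0]) (simp_all add: subspace_0[OF D] unbounded_operator_zero[OF T])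
  next
    case False
    define t where "t = e / (2 * norm y)"
    have t: "0 < t" using ae False by (simp add: t_def)
    have ty: "norm (t *\<^sub>R y) < e" using ae False by (simp add: t_def)
    \<comment> \<open>The tolerance is \<open>t * d\<close> because the error is divided by
      \<open>t\<close> when scaling back.\<close>
    obtain x where x: "x \<in> D" "norm x \<le> 2 * real n" "norm (t *\<^sub>R y - T x) < t * d"
      using small[OF subspace_scale[OF R y] ty, of "t * d"] t \<open>0 < d\<close> by auto
    let ?x = "(1 / t) *\<^sub>R x"
    have "norm ?x \<le> 2 * real n / t"
      using x t by (simp add: divide_right_mono)
    also have "\<dots> \<le> K * norm y"
      using ae False by (simp add: K_def t_def field_simps)
    finally have "norm ?x \<le> K * norm y" .
    moreover have "y - T ?x = (1 / t) *\<^sub>R (t *\<^sub>R y - T x)"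
      using t x by (simp add: unbounded_operator_scaleR[OF T] algebra_simps)
    then have "norm (y - T ?x) = norm (t *\<^sub>R y - T x) / t"
      using t by simp
    then have "norm (y - T ?x) < d"
      using x t by (simp add: pos_divide_less_eq mult.commute)
    ultimately show ?thesis
      using subspace_scale[OF D x(1)] by blast
  qed
  ultimately show thesis using that by blast
qed

theorem theorem2p4:
  fixes D :: "'e::banach set" and T :: "'e \<Rightarrow> 'f::banach"
  assumes "unbounded_operator D T"
    and "closed_operator D T"
  shows "closed (T ` D) \<longleftrightarrow>
    (\<exists>c>0. \<forall>y\<in>T ` D. \<exists>x\<in>D. T x = y \<and> norm x \<le> c * norm y)"
proof
  note D = unbounded_operator_subspace[OF assms(1)] and R = subspace_range[OF assms(1)]
  {
    assume "closed (T ` D)"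
    then obtain K where K: "0 < K"
      "\<And>y d. y \<in> T ` D \<Longrightarrow> 0 < d \<Longrightarrow> \<exists>x\<in>D. norm x \<le> K * norm y \<and> norm (y - T x) < d"
      using approximate_solution_bound[OF assms(1)] by metis
    have "\<exists>x\<in>D. norm x \<le> K * norm y \<and> norm (y - T x) \<le> norm y / 2 \<and> y - T x \<in> T ` D"
      if y: "y \<in> T ` D" for y
    \<comment> \<open>The tolerance \<open>norm y / 2\<close> is positive only for nonzero
      \<open>y\<close>; for \<open>y = 0\<close> the exact solution 0 serves.\<close>
    proof (cases "y = 0")
      case True
      then show ?thesis
        using y by (intro bexI[of _ 0])
          (simp_all add: subspace_0[OF D] unbounded_operator_zero[OF assms(1)])
    next
      case False
      then obtain x where "x \<in> D" "norm x \<le> K * norm y" "norm (y - T x) < norm y / 2"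
        using K(2)[OF y, of "norm y / 2"] by auto
      then show ?thesis
        using subspace_diff[OF R y] by (meson imageI less_imp_le)
    qed
    then have "\<forall>y\<in>T ` D. \<exists>x\<in>D. T x = y \<and> norm x \<le> 2 * K * norm y"
      using closed_operator_successive_approximation[OF assms, of K "T ` D"] K(1) by simp
    then show "\<exists>c>0. \<forall>y\<in>T ` D. \<exists>x\<in>D. T x = y \<and> norm x \<le> c * norm y"
      using K(1) by (intro exI[of _ "2 * K"]) simp
  next
    assume "\<exists>c>0. \<forall>y\<in>T ` D. \<exists>x\<in>D. T x = y \<and> norm x \<le> c * norm y"
    then obtain c where c: "c > 0"
      "\<And>y. y \<in> T ` D \<Longrightarrow> \<exists>x\<in>D. T x = y \<and> norm x \<le> c * norm y"
      by blast
    \<comment> \<open>Choose \<open>z\<close> in the range within \<open>norm y / 2\<close> of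
      \<open>y\<close> and solve \<open>T x = z\<close> exactly. Since
      \<open>norm z \<le> 2 * norm y\<close>, the bound \<open>c\<close> becomes
      \<open>2 * c\<close>.\<close>
    have "\<exists>x\<in>D. norm x \<le> 2 * c * norm y \<and> norm (y - T x) \<le> norm y / 2
        \<and> y - T x \<in> closure (T ` D)"
      if y: "y \<in> closure (T ` D)" for y
    proof (cases "y = 0")
      case True
      then show ?thesis
        using y by (intro bexI[of _ 0])
          (simp_all add: subspace_0[OF D] unbounded_operator_zero[OF assms(1)])
    next
      case False
      then obtain z where z: "z \<in> T ` D" "norm (y - z) < norm y / 2"
        using y unfolding closure_approachable
        by (metis dist_commute dist_norm half_gt_zero zero_less_norm_iff)
      obtain x where x: "x \<in> D" "T x = z" "norm x \<le> c * norm z"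
        using c(2)[OF z(1)] by blast
      have "norm z \<le> 2 * norm y"
        using z(2) norm_triangle_sub[of z y] norm_ge_zero[of y] norm_minus_commute[of z y]
        by linarith
      then have "norm x \<le> 2 * c * norm y"
        using order_trans[OF x(3) mult_left_mono[of "norm z" "2 * norm y" c]] c(1)
        by (simp add: mult_ac)
      moreover have "y - T x \<in> closure (T ` D)"
        using closure_subspace_diff[OF R y] x(1) by blast
      ultimately show ?thesis
        using x z by (auto intro!: bexI[of _ x])
    qed
    \<comment> \<open>Successive approximation now solves the equation exactly for every
      \<open>y\<close> in the closure, which puts the closure inside the range.\<close>
    then have "\<exists>x\<in>D. T x = y" if "y \<in> closure (T ` D)" for y
      using closed_operator_successive_approximation[OF assms, of "2 * c" "closure (T ` D)" y]
        that c(1) by auto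
    then have "closure (T ` D) \<subseteq> T ` D" by blast
    then show "closed (T ` D)"
      using closure_subset_eq by blast
  }
qed

end
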